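(* For every $t>2$ there exist a compact set $F\subseteq[0,1]$ and a choice of abstract rationals $P=(P(q))_{q\in\mathbb{N}}$ in $F$ such that $$\dim_{\mathrm P}F=1$$ and $$\dim_{\mathrm H}F_t=\dim_{\mathrm H}F=\frac{2}{t}=\frac{\dim_{\mathrm P}F+1}{t}.$$ In particular, in the general upper bound $\dim_{\mathrm H}F_t\leq(\dim_{\mathrm P}F+1)/t$ (valid for all $t\geq1$, all non-empty totally bounded metric spaces $F$ and all choices of abstract rationals) one cannot replace $\dim_{\mathrm P}F$ by $\dim_{\mathrm H}F$.
   Context: Subsets of $[0,1]$ carry the Euclidean metric $d$. For a non-empty totally bounded metric space $(F,d)$, a set $A\subseteq F$ is $r$-separated if $d(a,b)\geq r$ for all distinct $a,b\in A$. A choice of abstract rationals in $F$ is a family $P=(P(q))_{q\in\mathbb{N}}$, $\mathbb N=\{1,2,\dots\}$, where each $P(q)\subseteq F$ is a maximal $(1/q)$-separated set, i.e. it is $(1/q)$-separated and no further point of $F$ can be added while keeping it $(1/q)$-separated. Given such a choice and $t>0$, $$F_t=\bigcap_{N}\bigcup_{q>N}\bigcup_{p\in P(q)}B(p,1/q^t),$$ where $B(x,r)$ denotes the closed ball in $F$; that is, $F_t$ is the set of $x\in F$ such that for infinitely many $q$ there is $p\in P(q)$ with $d(p,x)\leq 1/q^t$. $\dim_{\mathrm H}$ denotes Hausdorff dimension. $N_r(X)$ denotes the maximum cardinality of an $r$-separated subset of $X$. The upper box dimension is $\overline{\dim}_{\mathrm B}X=\limsup_{r\to0}\frac{\log N_r(X)}{-\log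 r}$. The packing dimension is $\dim_{\mathrm P}X=\inf\{\sup_i\overline{\dim}_{\mathrm B}X_i : X=\bigcup_i X_i\}$, the infimum being over countable decompositions. *)

theory Defs
  imports "HOL-Analysis.Analysis"
begin

text \<open>
  A metric space \<open>F\<close> is represented as a subset of a type of class \<open>metric_space\<close>,
  with the restricted metric.
\<close>

definition separated_set :: "real \<Rightarrow> 'a::metric_space set \<Rightarrow> bool" where
  "separated_set r A \<longleftrightarrow> (\<forall>a\<in>A. \<forall>b\<in>A. a \<noteq> b \<longrightarrow> dist a b \<ge> r)"

definition maximal_separated :: "real \<Rightarrow> 'a::metric_space set \<Rightarrow> 'a set \<Rightarrow> bool" where
  "maximal_separated r F A \<longleftrightarrow>
     A \<subseteq> F \<and> separated_set r A \<and> (\<forall>x\<in>F - A. \<not> separated_set r (insert x A))"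

text \<open>Denominators are \<open>q \<ge> 1\<close>; the value \<open>P 0\<close> is irrelevant throughout.\<close>

definition abstract_rationals :: "'a::metric_space set \<Rightarrow> (nat \<Rightarrow> 'a set) \<Rightarrow> bool" where
  "abstract_rationals F P \<longleftrightarrow> (\<forall>q\<ge>1. maximal_separated (1 / real q) F (P q))"

definition well_approx :: "'a::metric_space set \<Rightarrow> (nat \<Rightarrow> 'a set) \<Rightarrow> real \<Rightarrow> 'a set" where
  "well_approx F P t =
     (\<Inter>N::nat. \<Union>q\<in>{N<..}. \<Union>p\<in>P q. cball p (1 / real q powr t) \<inter> F)"


subsection \<open>Hausdorff dimension\<close>

text \<open>
  The usual conventions \<open>diam {} ^ s = 0\<close> and \<open>0 ^ 0 = 1\<close> are made explicit because
  \<open>0 powr 0 = 0\<close> in the library.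
\<close>

definition diam_pow :: "real \<Rightarrow> 'a::metric_space set \<Rightarrow> ennreal" where
  "diam_pow s U =
     (if U = {} then 0 else if s = 0 then 1 else ennreal (diameter U powr s))"

text \<open>
  Boundedness of the covering sets is required because \<open>diameter\<close> is unspecified on
  unbounded sets. Covers may contain \<open>{}\<close>, so finite covers are included.
\<close>

definition hausdorff_premeasure ::
    "real \<Rightarrow> real \<Rightarrow> 'a::metric_space set \<Rightarrow> ennreal" where
  "hausdorff_premeasure s \<delta> X =
     (INF U \<in> {U :: nat \<Rightarrow> 'a set.
                 X \<subseteq> (\<Union>i. U i) \<and> (\<forall>i. bounded (U i) \<and> diameter (U i) \<le> \<delta>)}.
        \<Sum>i. diam_pow s (U i))"

definition hausdorff_measure :: "real \<Rightarrow> 'a::metric_space set \<Rightarrow> ennreal" where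
  "hausdorff_measure s X = (SUP \<delta>\<in>{0<..}. hausdorff_premeasure s \<delta> X)"

definition hausdorff_dim :: "'a::metric_space set \<Rightarrow> ereal" where
  "hausdorff_dim X = (INF s \<in> {s::real. s \<ge> 0 \<and> hausdorff_measure s X = 0}. ereal s)"


subsection \<open>Box and packing dimension\<close>

text \<open>Equal to the maximum whenever the set is totally bounded, and possibly \<open>\<infinity>\<close> otherwise.\<close>

definition separation_number :: "real \<Rightarrow> 'a::metric_space set \<Rightarrow> enat" where
  "separation_number r X =
     (SUP A \<in> {A. A \<subseteq> X \<and> finite A \<and> separated_set r A}. enat (card A))"

text \<open>As \<open>ln 0 = 0\<close> in the library, the empty set gets box dimension \<open>0\<close>.\<close>

definition ln_enat :: "enat \<Rightarrow> ereal" where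
  "ln_enat n = (case n of enat k \<Rightarrow> ereal (ln (real k)) | \<infinity> \<Rightarrow> \<infinity>)"

definition upper_box_dim :: "'a::metric_space set \<Rightarrow> ereal" where
  "upper_box_dim X =
     Limsup (at_right 0) (\<lambda>r::real. ln_enat (separation_number r X) / ereal (- ln r))"

definition packing_dim :: "'a::metric_space set \<Rightarrow> ereal" where
  "packing_dim X =
     (INF Y \<in> {Y :: nat \<Rightarrow> 'a set. X = (\<Union>i. Y i)}. SUP i. upper_box_dim (Y i))"

end

theory Submission
  imports Defs
begin

text \<open>
  Upper bound: if \<open>F\<close> is a countable union of sets \<open>Y\<close> of upper box dimension less than \<open>\<beta>\<close>, the points
  of \<open>P q\<close> within \<open>1 / q powr t\<close> of \<open>Y\<close> can be moved into \<open>Y\<close> without losing more than half of their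
  separation, so there are \<open>O(q powr \<beta>)\<close> of them, and the covers of \<open>F\<^sub>t \<inter> Y\<close> by the corresponding balls
  with \<open>q > N\<close> have summable \<open>s\<close>-th powers of diameters as soon as \<open>t s > \<beta> + 1\<close>.
  For \<open>t = 1\<close> the points cannot be moved, and maximal separated subsets of \<open>Y\<close> serve instead.

  Sharpness: take a homogeneous Cantor set whose intervals of level \<open>k\<close> have length about \<open>Q powr - t\<close>
  and lie at distance about \<open>1 / Q\<^sup>2\<close> of each other, for a rapidly increasing sequence of scales \<open>Q\<close>.
  Splitting the intervals of a level into \<open>Q\<close> residue classes makes each class \<open>1 / Q\<close>-separated, so
  the class \<open>j\<close> can be put into \<open>P (Q + j)\<close>, and then \<open>F\<^sub>t = F\<close>. The uniform mass on \<open>F\<close> gives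
  \<open>dim\<^sub>H F \<ge> 2 / t\<close>. As \<open>dim\<^sub>P F \<le> 1\<close>, the upper bound \<open>dim\<^sub>H F\<^sub>t \<le> (dim\<^sub>P F + 1) / t\<close> forces equality
  in both estimates; no direct lower bound for the packing dimension is needed.
\<close>

section \<open>Separated sets\<close>

lemma separated_set_subset: "separated_set r A \<Longrightarrow> B \<subseteq> A \<Longrightarrow> separated_set r B"
  unfolding separated_set_def by blast

lemma separated_set_mono: "separated_set r A \<Longrightarrow> r' \<le> r \<Longrightarrow> separated_set r' A"
  unfolding separated_set_def by force

text \<open>Zorn's lemma applies since any two points of the union of a chain lie in a common
  member, so the union stays separated.\<close>

lemma ex_maximal_separated_superset:
  fixes F :: "'a::metric_space set"
  assumes "B \<subseteq> F" "separated_set r B"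
  obtains A where "maximal_separated r F A" "B \<subseteq> A"
proof -
  let ?S = "{A. B \<subseteq> A \<and> A \<subseteq> F \<and> separated_set r A}"
  have "\<exists>M\<in>?S. \<forall>X\<in>?S. M \<subseteq> X \<longrightarrow> X = M"
  proof (rule subset_Zorn_nonempty)
    show "?S \<noteq> {}"
      using assms by auto
  next
    fix \<C> assume "\<C> \<noteq> {}" and chain: "subset.chain ?S \<C>"
    have sub: "\<C> \<subseteq> ?S"
      using chain by (simp add: subset_chain_def)
    have "separated_set r (\<Union>\<C>)"
      unfolding separated_set_def
    proof safe
      fix a b X Y assume ab: "a \<in> X" "X \<in> \<C>" "b \<in> Y" "Y \<in> \<C>" "a \<noteq> b"
      then have "X \<subseteq> Y \<or> Y \<subseteq> X"
        using chain by (auto simp: subset_chain_def)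
      then obtain Z where "Z \<in> \<C>" "a \<in> Z" "b \<in> Z"
        using ab by blast
      with sub \<open>a \<noteq> b\<close> show "r \<le> dist a b"
        by (auto simp: separated_set_def)
    qed
    with \<open>\<C> \<noteq> {}\<close> sub show "\<Union>\<C> \<in> ?S"
      by auto
  qed
  then obtain A where "A \<in> ?S" and max: "\<forall>X\<in>?S. A \<subseteq> X \<longrightarrow> X = A"
    by (elim bexE)
  then have A: "B \<subseteq> A" "A \<subseteq> F" "separated_set r A"
    by auto
  have "\<not> separated_set r (insert x A)" if "x \<in> F - A" for x
  proof
    assume sep: "separated_set r (insert x A)"
    have "insert x A \<in> ?S"
      using A sep that by auto
    then have "insert x A = A"
      using max by blast
    then show False
      using that by blast
  qed
  then have "maximal_separated r F A"
    unfolding maximal_separated_def using A by simp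
  then show thesis
    using A(1) by (rule that)
qed

lemma maximal_separated_covers:
  assumes "maximal_separated r F A" "x \<in> F" "r > 0"
  obtains a where "a \<in> A" "dist a x < r"
proof (cases "x \<in> A")
  case True
  then show ?thesis
    using that[of x] \<open>r > 0\<close> by simp
next
  case False
  then have "\<not> separated_set r (insert x A)" and "separated_set r A"
    using assms by (auto simp: maximal_separated_def)
  then have "\<exists>a\<in>A. \<not> r \<le> dist a x"
    by (auto simp: separated_set_def dist_commute)
  then show ?thesis
    using that by (auto simp: not_le)
qed


section \<open>Null sets for Hausdorff measure\<close>

text \<open>The supremum over \<delta> vanishes iff every infimum does, and an infimum vanishes iff
  covers of arbitrarily small cost exist. Null sets are proved and exploited below in this
  form.\<close>

lemma hausdorff_measure_eq_0_iff:
  "hausdorff_measure s X = 0 \<longleftrightarrow>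
     (\<forall>\<delta>>0. \<forall>\<epsilon>>0. \<exists>U::nat \<Rightarrow> 'a::metric_space set.
        X \<subseteq> (\<Union>i. U i) \<and> (\<forall>i. bounded (U i) \<and> diameter (U i) \<le> \<delta>) \<and>
        (\<Sum>i. diam_pow s (U i)) < ennreal \<epsilon>)"
proof -
  have zero_iff: "x = 0 \<longleftrightarrow> (\<forall>\<epsilon>>0. x < ennreal \<epsilon>)" for x
  proof
    assume *: "\<forall>\<epsilon>>0. x < ennreal \<epsilon>"
    show "x = 0"
    proof (rule ccontr)
      assume "x \<noteq> 0"
      then have "0 < x"
        by (simp add: zero_less_iff_neq_zero)
      then obtain y where y: "0 < y" "y < x"
        using dense by blast
      have "y \<noteq> top"
        using y by auto
      then have "y = ennreal (enn2real y)" "0 < enn2real y"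
        using y by (auto simp: enn2real_positive_iff top.not_eq_extremum)
      then show False
        using * y by (metis not_less_iff_gr_or_eq)
    qed
  qed auto
  have "hausdorff_measure s X = 0 \<longleftrightarrow> (\<forall>\<delta>>0. hausdorff_premeasure s \<delta> X = 0)"
    unfolding hausdorff_measure_def bot_ennreal[symmetric]
    by (subst SUP_bot_conv) auto
  also have "\<dots> \<longleftrightarrow> (\<forall>\<delta>>0. \<forall>\<epsilon>>0. hausdorff_premeasure s \<delta> X < ennreal \<epsilon>)"
    by (simp only: zero_iff[symmetric])
  finally show ?thesis
    by (simp add: hausdorff_premeasure_def INF_less_iff conj_assoc)
qed

lemma hausdorff_measure_0_mono:
  assumes "hausdorff_measure s Y = 0" "X \<subseteq> Y"
  shows "hausdorff_measure s X = 0"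
proof -
  have "hausdorff_premeasure s \<delta> X \<le> hausdorff_premeasure s \<delta> Y" for \<delta>
    unfolding hausdorff_premeasure_def using \<open>X \<subseteq> Y\<close> by (intro INF_superset_mono) auto
  then have "hausdorff_measure s X \<le> hausdorff_measure s Y"
    unfolding hausdorff_measure_def by (intro SUP_mono') auto
  then show ?thesis
    using assms by simp
qed

text \<open>Covers of the \<open>X n\<close> with geometrically decreasing costs are merged through
  a pairing of indices. Their costs add up to \<epsilon> / 2, which keeps the final bound
  strict.\<close>

lemma hausdorff_measure_0_UN:
  fixes X :: "nat \<Rightarrow> 'a::metric_space set"
  assumes "\<And>n. hausdorff_measure s (X n) = 0"
  shows "hausdorff_measure s (\<Union>n. X n) = 0"
  unfolding hausdorff_measure_eq_0_iff
proof (intro allI impI)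
  fix \<delta> \<epsilon> :: real assume "\<delta> > 0" "\<epsilon> > 0"
  have "\<exists>U::nat \<Rightarrow> 'a set. X n \<subseteq> (\<Union>i. U i) \<and> (\<forall>i. bounded (U i) \<and> diameter (U i) \<le> \<delta>) \<and>
     (\<Sum>i. diam_pow s (U i)) < ennreal (\<epsilon> / 2 * (1/2) ^ Suc n)" for n
  proof -
    have "\<epsilon> / 2 * (1/2) ^ Suc n > 0"
      using \<open>\<epsilon> > 0\<close> by simp
    then show ?thesis
      using assms[of n] \<open>\<delta> > 0\<close> unfolding hausdorff_measure_eq_0_iff by blast
  qed
  then obtain U :: "nat \<Rightarrow> nat \<Rightarrow> 'a set" where U: "\<And>n. X n \<subseteq> (\<Union>i. U n i)"
    "\<And>n i. bounded (U n i)" "\<And>n i. diameter (U n i) \<le> \<delta>"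
    "\<And>n. (\<Sum>i. diam_pow s (U n i)) < ennreal (\<epsilon> / 2 * (1/2) ^ Suc n)"
    by metis
  define V where "V m = case_prod U (prod_decode m)" for m
  have "(\<Sum>m. diam_pow s (V m)) = (\<Sum>n. \<Sum>i. diam_pow s (U n i))"
    unfolding V_def
    using suminf_ennreal_2dimen[of "\<lambda>n. \<Sum>i. diam_pow s (U n i)" "\<lambda>x. diam_pow s (case_prod U x)"]
    by simp
  also have "\<dots> \<le> (\<Sum>n. ennreal (\<epsilon> / 2 * (1/2) ^ Suc n))"
    using U(4) by (intro suminf_le) (auto intro: less_imp_le)
  also have "\<dots> = ennreal (\<epsilon> / 2)"
    using sums_mult[OF power_half_series, of "\<epsilon> / 2"] \<open>\<epsilon> > 0\<close>
    by (intro suminf_ennreal_eq) auto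
  also have "\<dots> < ennreal \<epsilon>"
    using \<open>\<epsilon> > 0\<close> by (simp add: ennreal_lessI)
  finally have "(\<Sum>m. diam_pow s (V m)) < ennreal \<epsilon>" .
  moreover have "(\<Union>n. X n) \<subseteq> (\<Union>m. V m)"
  proof
    fix x assume "x \<in> (\<Union>n. X n)"
    then obtain n i where "x \<in> U n i"
      using U(1) by blast
    then have "x \<in> V (prod_encode (n, i))"
      by (simp add: V_def)
    then show "x \<in> (\<Union>m. V m)"
      by blast
  qed
  moreover have "bounded (V m) \<and> diameter (V m) \<le> \<delta>" for m
    using U(2,3) by (simp add: V_def split_beta)
  ultimately show "\<exists>V::nat \<Rightarrow> 'a set. (\<Union>n. X n) \<subseteq> (\<Union>i. V i) \<and>
      (\<forall>i. bounded (V i) \<and> diameter (V i) \<le> \<delta>) \<and> (\<Sum>i. diam_pow s (V i)) < ennreal \<epsilon>"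
    by blast
qed

lemma diameter_cball_le:
  fixes x :: "'a::metric_space"
  assumes "r \<ge> 0"
  shows "diameter (cball x r) \<le> 2 * r"
proof -
  have "dist y z \<le> 2 * r" if "y \<in> cball x r" "z \<in> cball x r" for y z
    using dist_triangle2[of y z x] that by (auto simp: dist_commute)
  then show ?thesis
    using assms unfolding diameter_def by (auto intro!: cSUP_least)
qed

lemma diam_pow_cball_le:
  fixes x :: "'a::metric_space"
  assumes "r \<ge> 0" "s > 0"
  shows "diam_pow s (cball x r) \<le> ennreal ((2 * r) powr s)"
  using assms diameter_cball_le[OF assms(1), of x] diameter_ge_0[OF bounded_cball, of x r]
  by (auto simp: diam_pow_def intro!: ennreal_leI powr_mono2)

text \<open>A Borel-Cantelli argument: the balls with index \<open>q\<close> cost at most a constant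
  times \<open>q powr (\<beta> - t * s)\<close>. This is summable, and the balls of every tail still
  cover \<open>X\<close>.\<close>

lemma hausdorff_measure_0_limsup_cballs:
  fixes X :: "'a::metric_space set" and T :: "nat \<Rightarrow> 'a set"
  assumes T: "\<forall>\<^sub>F q in sequentially. finite (T q) \<and> real (card (T q)) \<le> C * real q powr \<beta>"
    and cover: "\<And>x N. x \<in> X \<Longrightarrow> \<exists>q>N. \<exists>p\<in>T q. dist p x \<le> real q powr - t"
    and "t > 0" "s > 0" "t * s > \<beta> + 1"
  shows "hausdorff_measure s X = 0"
  unfolding hausdorff_measure_eq_0_iff
proof (intro allI impI)
  fix \<delta> \<epsilon> :: real assume "\<delta> > 0" "\<epsilon> > 0"
  define r where "r q = real q powr - t" for q
  define f where "f q = C * 2 powr s * real q powr (\<beta> - t * s)" for q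
  have r_nonneg: "r q \<ge> 0" for q
    by (simp add: r_def)
  have "summable f"
    unfolding f_def using \<open>t * s > \<beta> + 1\<close>
    by (intro summable_mult) (simp add: summable_real_powr_iff)
  have "((\<lambda>q. 2 * r q) \<longlongrightarrow> 2 * 0) sequentially"
    unfolding r_def using \<open>t > 0\<close>
    by (intro tendsto_mult tendsto_const tendsto_neg_powr filterlim_real_sequentially) auto
  then have "\<forall>\<^sub>F q in sequentially. 2 * r q < \<delta>"
    using \<open>\<delta> > 0\<close> by (intro order_tendstoD) auto
  with T obtain N1 where N1: "\<And>q. q \<ge> N1 \<Longrightarrow> finite (T q)"
    "\<And>q. q \<ge> N1 \<Longrightarrow> real (card (T q)) \<le> C * real q powr \<beta>" "\<And>q. q \<ge> N1 \<Longrightarrow> 2 * r q < \<delta>"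
    unfolding eventually_sequentially by (metis le_cases order_trans)
  obtain N2 where N2: "\<And>n. n \<ge> N2 \<Longrightarrow> norm (\<Sum>i. f (i + n)) < \<epsilon>"
    using suminf_exist_split[OF \<open>\<epsilon> > 0\<close> \<open>summable f\<close>] by blast
  define N where "N = max 1 (max N1 N2)"
  have card_f: "real (card (T q)) * (2 * r q) powr s \<le> f q" if "q \<ge> N" for q
  proof -
    have "real (card (T q)) * (2 * r q) powr s \<le> C * real q powr \<beta> * (2 * r q) powr s"
      using N1(2)[of q] that by (intro mult_right_mono) (auto simp: N_def)
    also have "\<dots> = f q"
      using that r_nonneg by (simp add: f_def r_def N_def powr_mult powr_powr powr_add[symmetric])
    finally show ?thesis .
  qed
  have "\<forall>q. \<exists>h. q \<ge> N \<longrightarrow> bij_betw h {0..<card (T q)} (T q)"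
    using N1(1) by (auto simp: N_def intro: ex_bij_betw_nat_finite)
  then obtain h where h: "\<And>q. q \<ge> N \<Longrightarrow> bij_betw (h q) {0..<card (T q)} (T q)"
    by metis
  \<comment> \<open>Row \<open>q\<close> lists the finitely many balls around
    \<open>T (q + N)\<close>, padded with \<open>{}\<close>, whose \<open>diam_pow\<close> is
    0.\<close>
  define W where "W q i = (if i < card (T (q + N)) then cball (h (q + N) i) (r (q + N)) else {})"
    for q i :: nat
  define V where "V m = case_prod W (prod_decode m)" for m
  have "(\<Sum>m. diam_pow s (V m)) = (\<Sum>q. \<Sum>i. diam_pow s (W q i))"
    unfolding V_def
    using suminf_ennreal_2dimen[of "\<lambda>n. \<Sum>i. diam_pow s (W n i)" "\<lambda>x. diam_pow s (case_prod W x)"]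
    by simp
  also have "\<dots> \<le> (\<Sum>q. ennreal (f (q + N)))"
  proof (intro suminf_le)
    fix q
    have "(\<Sum>i. diam_pow s (W q i)) = (\<Sum>i<card (T (q + N)). diam_pow s (W q i))"
      by (intro suminf_finite) (auto simp: W_def diam_pow_def)
    also have "\<dots> \<le> (\<Sum>i<card (T (q + N)). ennreal ((2 * r (q + N)) powr s))"
      using \<open>s > 0\<close> r_nonneg by (intro sum_mono) (simp add: W_def diam_pow_cball_le)
    also have "\<dots> = ennreal (real (card (T (q + N))) * (2 * r (q + N)) powr s)"
      by (simp add: ennreal_mult ennreal_of_nat_eq_real_of_nat)
    also have "\<dots> \<le> ennreal (f (q + N))"
      by (intro ennreal_leI card_f) simp
    finally show "(\<Sum>i. diam_pow s (W q i)) \<le> ennreal (f (q + N))" .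
  qed auto
  also have "\<dots> = ennreal (\<Sum>q. f (q + N))"
  proof (intro suminf_ennreal2)
    \<comment> \<open>The sign comes from \<open>card_f\<close>, as nothing is known about the sign
      of \<open>C\<close>.\<close>
    show "0 \<le> f (q + N)" for q
      using card_f[of "q + N"] by (meson le_add2 mult_nonneg_nonneg of_nat_0_le_iff order_trans powr_ge_zero)
    show "summable (\<lambda>q. f (q + N))"
      using \<open>summable f\<close> by (simp add: summable_iff_shift)
  qed
  also have "\<dots> < ennreal \<epsilon>"
  proof (intro ennreal_lessI)
    show "(\<Sum>q. f (q + N)) < \<epsilon>"
      using N2[of N] by (simp add: N_def abs_less_iff del: One_nat_def)
  qed fact
  finally have "(\<Sum>m. diam_pow s (V m)) < ennreal \<epsilon>" .
  moreover have "X \<subseteq> (\<Union>m. V m)"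
  proof
    fix x assume "x \<in> X"
    then obtain q p where q: "q > N" "p \<in> T q" "dist p x \<le> r q"
      using cover unfolding r_def by blast
    then have "p \<in> h q ` {0..<card (T q)}"
      using h[of q] by (simp add: bij_betw_def)
    then obtain i where "i < card (T q)" "h q i = p"
      by auto
    then have "x \<in> W (q - N) i"
      using q by (simp add: W_def)
    then have "x \<in> V (prod_encode (q - N, i))"
      by (simp add: V_def)
    then show "x \<in> (\<Union>m. V m)"
      by blast
  qed
  moreover have "bounded (W q i) \<and> diameter (W q i) \<le> \<delta>" for q i
  proof -
    have "N1 \<le> q + N"
      by (simp add: N_def)
    then have "diameter (cball (h (q + N) i) (r (q + N))) \<le> \<delta>"
      using N1(3)[of "q + N"] diameter_cball_le[OF r_nonneg, of "h (q + N) i" "q + N"] by linarith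
    then show ?thesis
      using \<open>\<delta> > 0\<close> by (auto simp: W_def)
  qed
  then have "bounded (V m) \<and> diameter (V m) \<le> \<delta>" for m
    by (simp add: V_def split_beta)
  ultimately show "\<exists>V::nat \<Rightarrow> 'a set. X \<subseteq> (\<Union>i. V i) \<and>
      (\<forall>i. bounded (V i) \<and> diameter (V i) \<le> \<delta>) \<and> (\<Sum>i. diam_pow s (V i)) < ennreal \<epsilon>"
    by blast
qed


section \<open>The general upper bound\<close>

text \<open>The strict bound on the limsup can be multiplied by \<open>- ln r > 0\<close> and
  exponentiated, which leaves a counting bound without a constant.\<close>

lemma eventually_card_separated_le:
  fixes X :: "'a::metric_space set"
  assumes "upper_box_dim X < ereal \<beta>"
  shows "\<forall>\<^sub>F r in at_right 0. \<forall>A\<subseteq>X. separated_set r A \<longrightarrow>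
           finite A \<and> real (card A) \<le> r powr - \<beta>"
proof -
  have "\<forall>\<^sub>F r in at_right (0::real). ln_enat (separation_number r X) / ereal (- ln r) < ereal \<beta>"
    using assms unfolding upper_box_dim_def by (rule Limsup_lessD)
  moreover have "\<forall>\<^sub>F r in at_right (0::real). 0 < r \<and> r < 1"
    unfolding eventually_at_right_field by (auto intro: exI[of _ 1])
  ultimately show ?thesis
  proof eventually_elim
    case (elim r)
    then have ln_r: "- ln r > 0"
      by simp
    have ln_less: "ln_enat (separation_number r X) < ereal (\<beta> * - ln r)"
      using elim ln_r by (subst (asm) ereal_divide_less_iff) auto
    then obtain n where n: "separation_number r X = enat n"
      by (cases "separation_number r X") (auto simp: ln_enat_def)
    have n_le: "real n \<le> r powr - \<beta>"
    \<comment> \<open>Since \<open>ln 0 = 0\<close>, the logarithmic bound says nothing about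
      \<open>n = 0\<close>, where the claim is trivial.\<close>
    proof (cases "n = 0")
      case False
      have "ln (real n) < - \<beta> * ln r"
        using ln_less n by (simp add: ln_enat_def)
      then have "exp (ln (real n)) < exp (- \<beta> * ln r)"
        by simp
      then show ?thesis
        using False elim by (simp add: powr_def)
    qed auto
    show ?case
    proof (intro allI impI)
      fix A assume A: "A \<subseteq> X" "separated_set r A"
      have "card G \<le> n" if "G \<subseteq> A" "finite G" for G
      proof -
        have "enat (card G) \<le> separation_number r X"
          unfolding separation_number_def using that A separated_set_subset[OF A(2), of G]
          by (intro SUP_upper) auto
        then show ?thesis
          using n by simp
      qed
      \<comment> \<open>The separation number only sees finite sets; a uniform bound on the finite
        subsets of \<open>A\<close> makes \<open>A\<close> finite.\<close>
      then have "finite A \<and> card A \<le> n"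
        by (rule finite_if_finite_subsets_card_bdd)
      then show "finite A \<and> real (card A) \<le> r powr - \<beta>"
        using n_le by linarith
    qed
  qed
qed

lemma eventually_at_right_0_inverse:
  fixes c :: real
  assumes "\<forall>\<^sub>F r in at_right 0. Q r" "c > 0"
  shows "\<forall>\<^sub>F q in sequentially. Q (1 / (c * real q))"
proof -
  have "LIM q sequentially. c * real q :> at_top"
    using \<open>c > 0\<close> filterlim_real_sequentially
    by (intro filterlim_tendsto_pos_mult_at_top[OF tendsto_const]) auto
  then have "LIM q sequentially. inverse (c * real q) :> at_right 0"
    by (rule filterlim_compose[OF filterlim_inverse_at_right_top])
  then show ?thesis
    using assms(1) by (simp add: filterlim_iff field_simps)
qed

lemma upper_box_dim_nonneg: "0 \<le> upper_box_dim X"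
proof -
  have "\<forall>\<^sub>F r in at_right (0::real). 0 < r \<and> r < 1"
    unfolding eventually_at_right_field by (auto intro: exI[of _ 1])
  then have "\<forall>\<^sub>F r in at_right 0. 0 \<le> ln_enat (separation_number r X) / ereal (- ln r)"
  proof eventually_elim
    case (elim r)
    have "0 \<le> ln_enat (separation_number r X)"
    proof (cases "separation_number r X")
      case (enat k)
      then show ?thesis
        by (cases "k = 0") (auto simp: ln_enat_def)
    qed (simp add: ln_enat_def)
    then show ?case
      using elim by (intro zero_le_divide_ereal) auto
  qed
  then have "0 \<le> Liminf (at_right 0) (\<lambda>r::real. ln_enat (separation_number r X) / ereal (- ln r))"
    by (rule Liminf_bounded)
  also have "\<dots> \<le> upper_box_dim X"
    unfolding upper_box_dim_def by (intro Liminf_le_Limsup) (simp add: trivial_limit_at_right_real)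
  finally show ?thesis .
qed

lemma hausdorff_measure_0_well_approx_Int:
  fixes F Y :: "'a::metric_space set"
  assumes P: "abstract_rationals F P" and "t \<ge> 1" and "Y \<subseteq> F"
    and \<beta>: "upper_box_dim Y < ereal \<beta>" and s: "t * s > \<beta> + 1" "s > 0"
  shows "hausdorff_measure s (well_approx F P t \<inter> Y) = 0"
proof (cases "t = 1")
  case True
  \<comment> \<open>For \<open>t = 1\<close> a maximal \<open>1 / q\<close>-separated subset of
    \<open>Y\<close> has all of \<open>Y\<close> within distance \<open>1 / q\<close>, so the whole
    of \<open>Y\<close> is null.\<close>
  have "\<exists>A. maximal_separated (1 / real q) Y A" for q
    by (rule ex_maximal_separated_superset[of "{}" Y "1 / real q"]) (auto simp: separated_set_def)
  then obtain T where T: "\<And>q. maximal_separated (1 / real q) Y (T q)"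
    by metis
  have "\<forall>\<^sub>F q in sequentially. finite (T q) \<and> real (card (T q)) \<le> 1 * real q powr \<beta>"
    using eventually_at_right_0_inverse[OF eventually_card_separated_le[OF \<beta>], of 1, simplified]
  proof eventually_elim
    case (elim q)
    then show ?case
      using T[of q] by (auto simp: maximal_separated_def powr_minus powr_divide)
  qed
  then have "hausdorff_measure s Y = 0"
  proof (rule hausdorff_measure_0_limsup_cballs)
    fix x N assume "x \<in> Y"
    then obtain a where "a \<in> T (Suc N)" "dist a x < 1 / real (Suc N)"
      using maximal_separated_covers[OF T] by (metis of_nat_0_less_iff zero_less_Suc zero_less_divide_1_iff)
    then show "\<exists>q>N. \<exists>p\<in>T q. dist p x \<le> real q powr - t"
      using True by (intro exI[of _ "Suc N"]) (auto simp: powr_minus divide_inverse intro!: bexI[of _ a])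
  qed (use s True in auto)
  then show ?thesis
    by (rule hausdorff_measure_0_mono) simp
next
  case False
  with \<open>t \<ge> 1\<close> have "t > 1"
    by simp
  define T where "T q = {p \<in> P q. \<exists>y\<in>Y. dist p y \<le> real q powr - t}" for q
  \<comment> \<open>The bound 1 / 4 means that each point moves by less than
    \<open>1 / (4 * q)\<close>. Two points at distance at least \<open>1 / q\<close> thus stay more
    than \<open>1 / (2 * q)\<close> apart, which is the scale at which subsets of \<open>Y\<close>
    are counted.\<close>
  have "((\<lambda>q. real q powr - (t - 1)) \<longlongrightarrow> 0) sequentially"
    using \<open>t > 1\<close> by (intro tendsto_neg_powr filterlim_real_sequentially) auto
  then have "\<forall>\<^sub>F q in sequentially. real q powr - (t - 1) < 1 / 4"
    by (intro order_tendstoD) auto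
  then have "\<forall>\<^sub>F q in sequentially. finite (T q) \<and> real (card (T q)) \<le> 2 powr \<beta> * real q powr \<beta>"
    using eventually_at_right_0_inverse[OF eventually_card_separated_le[OF \<beta>], of 2, simplified]
      eventually_gt_at_top[of 0]
  proof eventually_elim
    case (elim q)
    have "\<forall>p. \<exists>y. p \<in> T q \<longrightarrow> y \<in> Y \<and> dist p y \<le> real q powr - t"
      by (auto simp: T_def)
    then obtain y where y: "\<And>p. p \<in> T q \<Longrightarrow> y p \<in> Y" "\<And>p. p \<in> T q \<Longrightarrow> dist p (y p) \<le> real q powr - t"
      by metis
    have "real q powr - t = real q powr - (t - 1) / real q"
      using elim(3) powr_diff[of "real q" "- (t - 1)" 1] by simp
    then have small: "real q powr - t < 1 / (4 * real q)"
      using elim(1,3) by (simp add: field_simps)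
    have sep: "1 / (2 * real q) < dist (y p) (y p')" if "p \<in> T q" "p' \<in> T q" "p \<noteq> p'" for p p'
    proof -
      have "1 / real q \<le> dist p p'"
        using that P elim(3) by (auto simp: T_def abstract_rationals_def maximal_separated_def separated_set_def)
      also have "\<dots> \<le> dist p (y p) + dist (y p) (y p') + dist p' (y p')"
        using dist_triangle[of p p' "y p"] dist_triangle[of "y p" p' "y p'"]
        by (simp add: dist_commute)
      also have "\<dots> < dist (y p) (y p') + 2 * (1 / (4 * real q))"
        using y(2)[OF that(1)] y(2)[OF that(2)] small by linarith
      finally show ?thesis
        by (simp add: field_simps)
    qed
    have "inj_on y (T q)"
    proof (rule inj_onI, rule ccontr)
      fix p p' assume "p \<in> T q" "p' \<in> T q" "y p = y p'" "p \<noteq> p'"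
      with sep[of p p'] show False
        by simp
    qed
    have "separated_set (1 / (2 * real q)) (y ` T q)"
      unfolding separated_set_def using sep by (force intro: less_imp_le)
    then have "finite (y ` T q)" "real (card (y ` T q)) \<le> (1 / (2 * real q)) powr - \<beta>"
      using elim(2) y(1) by (auto simp: image_subset_iff)
    moreover have "(1 / (2 * real q)) powr - \<beta> = 2 powr \<beta> * real q powr \<beta>"
      using elim(3) by (simp add: powr_divide powr_mult powr_minus field_simps)
    ultimately show ?case
      using \<open>inj_on y (T q)\<close> by (auto simp: card_image finite_image_iff)
  qed
  then show ?thesis
  proof (rule hausdorff_measure_0_limsup_cballs)
    fix x N assume x: "x \<in> well_approx F P t \<inter> Y"
    then have "x \<in> (\<Union>q\<in>{N<..}. \<Union>p\<in>P q. cball p (1 / real q powr t) \<inter> F)"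
      unfolding well_approx_def by blast
    then obtain q p where "q > N" "p \<in> P q" "dist p x \<le> real q powr - t"
      by (auto simp: powr_minus divide_inverse)
    with x show "\<exists>q>N. \<exists>p\<in>T q. dist p x \<le> real q powr - t"
      by (auto simp: T_def)
  qed (use s \<open>t > 1\<close> in auto)
qed

text \<open>Any \<open>z\<close> above the bound leaves room for one \<beta> that exceeds the box
  dimensions of all pieces of a suitable countable decomposition. Each piece of the limsup set is
  then null, and so is their union.\<close>

theorem hausdorff_dim_well_approx_le:
  fixes F :: "'a::metric_space set"
  assumes "abstract_rationals F P" "t \<ge> 1"
  shows "hausdorff_dim (well_approx F P t) \<le> (packing_dim F + 1) / ereal t"
proof (rule dense_ge)
  fix z assume z: "(packing_dim F + 1) / ereal t < z"
  \<comment> \<open>This forces \<open>s > 0\<close> below and excludes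
    \<open>z = - \<infinity>\<close>.\<close>
  have pos: "0 \<le> packing_dim F"
    unfolding packing_dim_def
    by (intro INF_greatest SUP_upper2[OF UNIV_I] upper_box_dim_nonneg)
  show "hausdorff_dim (well_approx F P t) \<le> z"
  proof (cases z)
    case (real s)
    have less: "packing_dim F + 1 < ereal (s * t)"
      using z real \<open>t \<ge> 1\<close> by (subst (asm) ereal_divide_less_iff) auto
    then have "packing_dim F < ereal (s * t - 1)"
      by (cases "packing_dim F") (auto simp: one_ereal_def)
    then obtain Y where "Y \<in> {Y :: nat \<Rightarrow> 'a set. F = (\<Union>i. Y i)}"
      and Y_less: "(SUP i. upper_box_dim (Y i)) < ereal (s * t - 1)"
      unfolding packing_dim_def INF_less_iff by (elim bexE)
    then have Y: "F = (\<Union>i. Y i)"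
      by simp
    then obtain \<beta> where \<beta>: "(SUP i. upper_box_dim (Y i)) < ereal \<beta>" "\<beta> < s * t - 1"
      using ereal_dense2[OF Y_less] by auto
    have "0 < s * t"
      using less pos by (cases "packing_dim F") (auto simp: one_ereal_def)
    then have "s > 0"
      using \<open>t \<ge> 1\<close> by (simp add: zero_less_mult_iff)
    have "hausdorff_measure s (well_approx F P t \<inter> Y i) = 0" for i
    proof (rule hausdorff_measure_0_well_approx_Int[OF assms])
      show "Y i \<subseteq> F"
        using Y by blast
      have "upper_box_dim (Y i) \<le> (SUP i. upper_box_dim (Y i))"
        by (intro SUP_upper) simp
      then show "upper_box_dim (Y i) < ereal \<beta>"
        using \<beta>(1) by (rule le_less_trans)
    qed (use \<beta>(2) \<open>s > 0\<close> in \<open>auto simp: mult.commute\<close>)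
    then have "hausdorff_measure s (\<Union>i. well_approx F P t \<inter> Y i) = 0"
      by (rule hausdorff_measure_0_UN)
    moreover have "well_approx F P t \<subseteq> (\<Union>i. well_approx F P t \<inter> Y i)"
      using Y by (auto simp: well_approx_def)
    ultimately have "hausdorff_measure s (well_approx F P t) = 0"
      by (rule hausdorff_measure_0_mono)
    then show ?thesis
      unfolding hausdorff_dim_def real using \<open>s > 0\<close> by (intro INF_lower) auto
  next
    case MInf
    have "0 \<le> (packing_dim F + 1) / ereal t"
      using pos \<open>t \<ge> 1\<close> by (intro zero_le_divide_ereal) auto
    then show ?thesis
      using z MInf by auto
  qed auto
qed


section \<open>Dimension bounds on the line\<close>

text \<open>The map sending \<open>a\<close> to the floor of \<open>a / r\<close> is injective on an
  \<open>r\<close>-separated set, with at most \<open>1 / r + 1\<close> values.\<close>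

lemma card_separated_unit_interval_le:
  fixes A :: "real set"
  assumes "A \<subseteq> {0..1}" "separated_set r A" "0 < r" "r \<le> 1"
  shows "real (card A) \<le> 2 / r"
proof -
  define f where "f a = \<lfloor>a / r\<rfloor>" for a
  have "inj_on f A"
  proof (rule inj_onI, rule ccontr)
    fix a b assume ab: "a \<in> A" "b \<in> A" "f a = f b" "a \<noteq> b"
    then have "\<bar>a / r - b / r\<bar> < 1"
      unfolding f_def by linarith
    then have "\<bar>a - b\<bar> < r"
      using \<open>0 < r\<close> by (simp add: diff_divide_distrib[symmetric] abs_divide)
    then show False
      using ab assms(2) by (fastforce simp: separated_set_def dist_real_def)
  qed
  moreover have "f ` A \<subseteq> {0..\<lfloor>1 / r\<rfloor>}"
    using assms by (force simp: f_def intro!: floor_mono divide_right_mono divide_nonneg_pos)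
  ultimately have "card A \<le> card {0..\<lfloor>1 / r\<rfloor>}"
    by (intro card_inj_on_le) auto
  moreover have "0 \<le> \<lfloor>1 / r\<rfloor>"
    using \<open>0 < r\<close> by simp
  ultimately have "real (card A) \<le> 1 / r + 1"
    unfolding card_atLeastAtMost_int by linarith
  also have "\<dots> \<le> 2 / r"
    using assms by (simp add: field_simps)
  finally show ?thesis .
qed

lemma upper_box_dim_unit_interval_le:
  fixes X :: "real set"
  assumes "X \<subseteq> {0..1}"
  shows "upper_box_dim X \<le> 1"
proof -
  \<comment> \<open>The quotient that results from the count \<open>2 / r\<close>; it tends to
    1.\<close>
  define h where "h r = ereal ((ln 2 - ln r) / - ln r)" for r :: real
  have le_h: "\<forall>\<^sub>F r in at_right (0::real). ln_enat (separation_number r X) / ereal (- ln r) \<le> h r"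
    unfolding eventually_at_right_field
  proof (intro exI[of _ 1] conjI allI impI)
    fix r :: real assume r: "0 < r" "r < 1"
    have "separation_number r X \<le> enat (nat \<lfloor>2 / r\<rfloor>)"
      unfolding separation_number_def
    proof (rule SUP_least)
      fix A assume "A \<in> {A. A \<subseteq> X \<and> finite A \<and> separated_set r A}"
      then have "real (card A) \<le> 2 / r"
        using assms r by (intro card_separated_unit_interval_le) auto
      then show "enat (card A) \<le> enat (nat \<lfloor>2 / r\<rfloor>)"
        by (simp add: le_nat_floor)
    qed
    then obtain k where k: "separation_number r X = enat k" "k \<le> nat \<lfloor>2 / r\<rfloor>"
      by (cases "separation_number r X") auto
    have "real k \<le> 2 / r"
      using k(2) r by (simp add: le_nat_iff le_floor_iff)
    moreover have "1 \<le> 2 / r"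
      using r by simp
    ultimately have "ln (real k) \<le> ln (2 / r)"
      by (cases "k = 0") (auto intro: ln_mono)
    then have "ln (real k) / - ln r \<le> (ln 2 - ln r) / - ln r"
      using r by (intro divide_right_mono) (auto simp: ln_div)
    then show "ln_enat (separation_number r X) / ereal (- ln r) \<le> h r"
      using r by (simp add: k ln_enat_def h_def)
  qed simp
  have "((\<lambda>r::real. 1 - ln 2 / ln r) \<longlongrightarrow> 1 - 0) (at_right 0)"
    by (intro tendsto_diff tendsto_const tendsto_divide_0[OF tendsto_const]
        filterlim_at_bot_imp_at_infinity ln_at_0)
  moreover have "\<forall>\<^sub>F r in at_right (0::real). 1 - ln 2 / ln r = (ln 2 - ln r) / - ln r"
    unfolding eventually_at_right_field
    by (intro exI[of _ 1]) (auto simp: field_simps)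
  ultimately have "((\<lambda>r::real. (ln 2 - ln r) / - ln r) \<longlongrightarrow> 1) (at_right 0)"
    by (simp cong: filterlim_cong add: tendsto_cong)
  then have "(h \<longlongrightarrow> 1) (at_right 0)"
    unfolding h_def one_ereal_def by (intro tendsto_ereal)
  then have "Limsup (at_right 0) h = 1"
    by (intro lim_imp_Limsup) (simp_all add: trivial_limit_at_right_real)
  then show ?thesis
    unfolding upper_box_dim_def using Limsup_mono[OF le_h] by simp
qed

lemma packing_dim_le_upper_box_dim: "packing_dim X \<le> upper_box_dim X"
proof -
  have "packing_dim X \<le> (SUP i::nat. upper_box_dim X)"
    unfolding packing_dim_def by (intro INF_lower) auto
  then show ?thesis
    by simp
qed

text \<open>
  The mass distribution principle: \<open>g\<close> plays the role of the quantile function of the measure, so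
  that the mass of a set is the Lebesgue measure of its preimage under \<open>g\<close>.
\<close>

lemma hausdorff_dim_ge:
  fixes g :: "real \<Rightarrow> 'a::metric_space"
  assumes range: "g ` {0..<1} \<subseteq> X" and "d > 0"
    and hoelder: "\<And>s. 0 < s \<Longrightarrow> s < d \<Longrightarrow>
      \<exists>C>0. \<forall>u\<in>{0..<1}. \<forall>v\<in>{0..<1}. \<bar>u - v\<bar> \<le> C * dist (g u) (g v) powr s"
  shows "ereal d \<le> hausdorff_dim X"
  unfolding hausdorff_dim_def
proof (rule INF_greatest)
  fix s :: real assume s: "s \<in> {s. s \<ge> 0 \<and> hausdorff_measure s X = 0}"
  show "ereal d \<le> ereal s"
  proof (rule ccontr)
    assume "\<not> ereal d \<le> ereal s"
    \<comment> \<open>The estimate on \<open>g\<close> is available only for exponents in the open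
      interval from 0 to \<open>d\<close>, while \<open>s\<close> may be 0.\<close>
    define \<sigma> where "\<sigma> = (s + d) / 2"
    have \<sigma>: "0 < \<sigma>" "\<sigma> < d" "s < \<sigma>"
      using s \<open>\<not> ereal d \<le> ereal s\<close> \<open>d > 0\<close> by (auto simp: \<sigma>_def)
    obtain C where C: "C > 0"
      "\<And>u v. u \<in> {0..<1} \<Longrightarrow> v \<in> {0..<1} \<Longrightarrow> \<bar>u - v\<bar> \<le> C * dist (g u) (g v) powr \<sigma>"
      using hoelder[OF \<sigma>(1,2)] by blast
    \<comment> \<open>Diameters at most 1 allow \<open>s\<close> to be replaced by the larger
      \<sigma>. The interval \<open>I i\<close> below has length
      \<open>2 * C * diameter (U i) powr \<sigma>\<close>, so a cost below
      \<open>1 / (2 * C)\<close> gives total length below 1, too little to cover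
      \<open>{0..<1}\<close>.\<close>
    have "(0::real) < 1" "0 < 1 / (2 * C)"
      using C(1) by auto
    then obtain U :: "nat \<Rightarrow> 'a set" where U: "X \<subseteq> (\<Union>i. U i)"
      "\<And>i. bounded (U i)" "\<And>i. diameter (U i) \<le> 1"
      "(\<Sum>i. diam_pow s (U i)) < ennreal (1 / (2 * C))"
      using s unfolding mem_Collect_eq hausdorff_measure_eq_0_iff by metis
    define V where "V i = {u \<in> {0..<1}. g u \<in> U i}" for i
    define \<rho> where "\<rho> i = C * diameter (U i) powr \<sigma>" for i
    define c where "c i = (SOME u. u \<in> V i)" for i
    \<comment> \<open>Nothing is known about the measurability of \<open>V i\<close>, so it is
      enlarged to an interval around one of its points.\<close>
    define I where "I i = (if V i = {} then {} else {c i - \<rho> i..c i + \<rho> i})" for i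
    have \<rho>_nonneg: "0 \<le> \<rho> i" for i
      using C(1) by (simp add: \<rho>_def)
    have V_I: "V i \<subseteq> I i" for i
    proof
      fix v assume v: "v \<in> V i"
      then have "c i \<in> V i"
        unfolding c_def by (rule someI)
      then have "\<bar>c i - v\<bar> \<le> C * dist (g (c i)) (g v) powr \<sigma>"
        using v by (intro C(2)) (auto simp: V_def)
      also have "\<dots> \<le> \<rho> i"
        unfolding \<rho>_def using C(1) \<sigma>(1) v \<open>c i \<in> V i\<close> U(2)
        by (intro mult_left_mono powr_mono2 diameter_bounded_bound) (auto simp: V_def)
      finally show "v \<in> I i"
        using v by (auto simp: I_def abs_le_iff)
    qed
    have emeasure_I: "emeasure lborel (I i) \<le> ennreal (2 * C) * diam_pow s (U i)" for i
    proof (cases "V i = {}")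
      case False
      then have "U i \<noteq> {}"
        by (auto simp: V_def)
      have diam: "0 \<le> diameter (U i)"
        using U(2) by (rule diameter_ge_0)
      have "ennreal (diameter (U i) powr \<sigma>) \<le> diam_pow s (U i)"
      proof (cases "s = 0")
        case True
        then show ?thesis
          using \<open>U i \<noteq> {}\<close> diam U(3)[of i] \<sigma>(1)
          by (auto simp: diam_pow_def powr_le1 intro: ennreal_leI[of _ 1, simplified])
      next
        case False
        then show ?thesis
          using \<open>U i \<noteq> {}\<close> diam U(3)[of i] \<sigma>(3) s
          by (auto simp: diam_pow_def intro!: ennreal_leI powr_mono')
      qed
      moreover have "emeasure lborel (I i) = ennreal (2 * C) * ennreal (diameter (U i) powr \<sigma>)"
        using \<rho>_nonneg[of i] C(1) False
        by (simp add: I_def \<rho>_def ennreal_mult[symmetric])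
      ultimately show ?thesis
        by (simp add: mult_left_mono)
    qed (simp add: I_def)
    have "{0..<1} \<subseteq> (\<Union>i. V i)"
      using range U(1) by (fastforce simp: V_def)
    then have "{0..<1} \<subseteq> (\<Union>i. I i)"
      using V_I by blast
    moreover have meas: "I i \<in> sets lborel" for i
      by (simp add: I_def)
    ultimately have "emeasure lborel {0..<1::real} \<le> emeasure lborel (\<Union>i. I i)"
      by (intro emeasure_mono) auto
    also have "\<dots> \<le> (\<Sum>i. emeasure lborel (I i))"
      using meas by (intro emeasure_subadditive_countably) auto
    also have "\<dots> \<le> (\<Sum>i. ennreal (2 * C) * diam_pow s (U i))"
      using emeasure_I by (intro suminf_le) auto
    also have "\<dots> = ennreal (2 * C) * (\<Sum>i. diam_pow s (U i))"
      by simp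
    also have "\<dots> < ennreal (2 * C) * ennreal (1 / (2 * C))"
      using U(4) C(1) by (intro ennreal_mult_strict_left_mono) auto
    also have "\<dots> = 1"
      using C(1) by (simp add: ennreal_mult[symmetric])
    finally show False
      by simp
  qed
qed


section \<open>The Cantor set\<close>

locale jarnik_cantor =
  fixes t :: real
  assumes t_gt_2: "t > 2"
begin

text \<open>
  An interval of level \<open>k\<close> has length \<open>L k\<close> and contains \<open>b k\<close> intervals of level \<open>k + 1\<close>, whose left end
  points have spacing \<open>w k\<close>; there are \<open>M k\<close> intervals of level \<open>k\<close>. The points of the Cantor set are
  parametrised by \<open>u \<in> [0, 1)\<close> through the mixed radix expansion of \<open>u\<close> with bases \<open>b 0, b 1, \<dots>\<close>,
  and \<open>fl k u\<close> is the index of the level \<open>k\<close> interval that contains \<open>g u\<close>. The exponent \<open>Suc k\<close> in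
  the recursion for \<open>Q\<close> makes all earlier scales negligible.
\<close>

primrec Q :: "nat \<Rightarrow> nat" where
  "Q 0 = 1"
| "Q (Suc k) = nat \<lceil>(4 * (2 * real (Q k)) powr t) ^ Suc k\<rceil>"

text \<open>The factor 2 serves all denominators \<open>q = Q k + j\<close> with
  \<open>j < Q k\<close> at once: \<open>q < 2 * Q k\<close> gives
  \<open>L k \<le> q powr - t\<close>.\<close>

definition L :: "nat \<Rightarrow> real" where
  "L k = (2 * real (Q k)) powr - t"

definition b :: "nat \<Rightarrow> nat" where
  "b k = nat \<lfloor>L k * (real (Q (Suc k)))\<^sup>2 / 2\<rfloor>"

definition M :: "nat \<Rightarrow> nat" where
  "M k = (\<Prod>j<k. b j)"

definition fl :: "nat \<Rightarrow> real \<Rightarrow> int" where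
  "fl k u = \<lfloor>real (M k) * u\<rfloor>"

definition digit :: "nat \<Rightarrow> real \<Rightarrow> int" where
  "digit k u = fl (Suc k) u mod int (b k)"

definition w :: "nat \<Rightarrow> real" where
  "w k = 2 / (real (Q (Suc k)))\<^sup>2"

text \<open>The left end point of the level \<open>n\<close> interval that contains
  \<open>g u\<close>.\<close>

definition S :: "nat \<Rightarrow> real \<Rightarrow> real" where
  "S n u = (\<Sum>k<n. of_int (digit k u) * w k)"

definition g :: "real \<Rightarrow> real" where
  "g u = (\<Sum>k. of_int (digit k u) * w k)"

definition F :: "real set" where
  "F = closure (g ` {0..<1})"

text \<open>Integrality of \<open>M (Suc k) * u\<close> makes all digits from \<open>Suc k\<close>
  on vanish, so these are left end points of level \<open>Suc k\<close> intervals, sorted by the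
  residue of their last digit.\<close>

definition cls :: "nat \<Rightarrow> nat \<Rightarrow> real set" where
  "cls k j = g ` {u \<in> {0..<1}. real (M (Suc k)) * u \<in> \<int> \<and> digit k u mod int (Q (Suc k)) = int j}"

declare Q.simps(2) [simp del]

section \<open>Growth of the scales\<close>

lemma Q_pos: "0 < Q k"
proof (induction k)
  case (Suc k)
  then have "0 < (4 * (2 * real (Q k)) powr t) ^ Suc k"
    by (intro zero_less_power mult_pos_pos) auto
  then show ?case
    by (simp add: Q.simps(2))
qed simp

text \<open>Here \<open>t > 2\<close> makes the length \<open>L k\<close> at most an eighth of
  \<open>2 / Q k ^ 2\<close>, the spacing of the level \<open>k\<close> intervals within their
  parent.\<close>

lemma powr_t_ge: "4 * (real (Q k))\<^sup>2 \<le> (2 * real (Q k)) powr t"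
proof -
  have "4 * (real (Q k))\<^sup>2 = (2 * real (Q k)) powr 2"
    using Q_pos[of k] by (simp add: powr_numeral power_mult_distrib)
  also have "\<dots> \<le> (2 * real (Q k)) powr t"
    using Q_pos[of k] t_gt_2 by (intro powr_mono) auto
  finally show ?thesis .
qed

lemma Q_Suc_ge_power: "(4 * (2 * real (Q k)) powr t) ^ Suc k \<le> real (Q (Suc k))"
  unfolding Q.simps(2) by (rule real_nat_ceiling_ge)

lemma Q_Suc_ge: "4 * (2 * real (Q k)) powr t \<le> real (Q (Suc k))"
proof -
  have "1 \<le> real (Q k)"
    using Q_pos[of k] by simp
  then have "1 \<le> 4 * (2 * real (Q k)) powr t"
    using powr_t_ge[of k] one_le_power[of "real (Q k)" 2] by linarith
  then have "(4 * (2 * real (Q k)) powr t) ^ 1 \<le> (4 * (2 * real (Q k)) powr t) ^ Suc k"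
    by (intro power_increasing) auto
  with Q_Suc_ge_power[of k] show ?thesis
    by simp
qed

text \<open>Squaring makes the gaps of earlier levels at least \<open>1 / Q\<close> for the current
  scale \<open>Q\<close>; doubling keeps the blocks of denominators from \<open>Q\<close> to
  \<open>2 * Q - 1\<close> of different levels disjoint.\<close>

lemma Q_Suc_ge_square: "(Q k)\<^sup>2 \<le> Q (Suc k)" and Q_Suc_ge_double: "2 * Q k \<le> Q (Suc k)"
proof -
  have *: "16 * (real (Q k))\<^sup>2 \<le> real (Q (Suc k))"
    using Q_Suc_ge[of k] powr_t_ge[of k] by linarith
  then have "(real (Q k))\<^sup>2 \<le> real (Q (Suc k))"
    using zero_le_power2[of "real (Q k)"] by linarith
  then show "(Q k)\<^sup>2 \<le> Q (Suc k)"
    by (metis of_nat_le_iff of_nat_power)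
  have "real (Q k) \<le> (real (Q k))\<^sup>2"
    using Q_pos[of k] by (simp add: self_le_power)
  then have "2 * real (Q k) \<le> real (Q (Suc k))"
    using * by linarith
  then show "2 * Q k \<le> Q (Suc k)"
    by linarith
qed

lemma Q_mono: "i \<le> j \<Longrightarrow> Q i \<le> Q j"
proof (induction rule: dec_induct)
  case (step n)
  then show ?case
    using Q_Suc_ge_double[of n] by linarith
qed simp

lemma less_Q: "k < Q k"
proof (induction k)
  case (Suc k)
  then show ?case
    using Q_Suc_ge_double[of k] by linarith
qed simp

section \<open>Lengths and branching numbers\<close>

lemma L_pos: "0 < L k"
  using Q_pos[of k] by (simp add: L_def)

lemma L_le: "L k \<le> 1 / (real (Q k))\<^sup>2 / 4"
  using powr_t_ge[of k] Q_pos[of k] by (simp add: L_def powr_minus field_simps)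

text \<open>The number \<open>?x\<close> that is rounded down to \<open>b k\<close> is at least 2,
  so rounding loses at most half of it.\<close>

lemma b_less: "real (b k) * w k \<le> L k"
  and b_ge: "L k * (real (Q (Suc k)))\<^sup>2 / 4 \<le> real (b k)" and b_ge_2: "2 \<le> b k"
proof -
  let ?x = "L k * (real (Q (Suc k)))\<^sup>2 / 2"
  have "4 \<le> L k * real (Q (Suc k))"
    using Q_Suc_ge[of k] Q_pos[of k] by (simp add: L_def powr_minus field_simps)
  then have "4 * 1 \<le> (L k * real (Q (Suc k))) * real (Q (Suc k))"
    using Q_pos[of "Suc k"] by (intro mult_mono) (auto simp: Suc_le_eq)
  then have x: "2 \<le> ?x"
    by (simp add: power2_eq_square mult.assoc)
  then have b: "real (b k) = of_int \<lfloor>?x\<rfloor>"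
    unfolding b_def by simp
  then have "real (b k) \<le> ?x"
    by linarith
  then show "real (b k) * w k \<le> L k"
    unfolding w_def using Q_pos[of "Suc k"] by (simp add: field_simps)
  have "?x / 2 \<le> real (b k)"
    using b x by linarith
  then show "L k * (real (Q (Suc k)))\<^sup>2 / 4 \<le> real (b k)"
    by simp
  show "2 \<le> b k"
    using b x by linarith
qed

lemma M_Suc: "M (Suc k) = M k * b k"
  by (simp add: M_def)

lemma M_ge: "2 ^ k \<le> M k"
proof (induction k)
  case (Suc k)
  then show ?case
    using mult_le_mono[OF Suc b_ge_2[of k]] by (simp add: M_Suc mult.commute)
qed (simp add: M_def)

lemma M_pos: "0 < M k"
  using M_ge[of k] by (metis gr0I not_less power_not_zero le_zero_eq zero_neq_numeral)

section \<open>Mixed radix digits and the map \<open>g\<close>\<close>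

lemma fl_0: "u \<in> {0..<1} \<Longrightarrow> fl 0 u = 0"
  by (simp add: fl_def M_def floor_eq_iff)

text \<open>The floor of a quotient by a positive integer is unchanged when the numerator is rounded
  down first. This gives the index of the parent interval.\<close>

lemma fl_eq_div: "fl k u = fl (Suc k) u div int (b k)"
proof -
  have "fl k u = \<lfloor>real (M (Suc k)) * u / of_int (int (b k))\<rfloor>"
    using b_ge_2[of k] by (simp add: fl_def M_Suc)
  also have "\<dots> = fl (Suc k) u div int (b k)"
    unfolding fl_def by (rule floor_divide_real_eq_div) simp
  finally show ?thesis .
qed

lemma digit_bounds: "0 \<le> digit k u" "digit k u < int (b k)"
  using b_ge_2[of k] by (auto simp: digit_def)

lemma fl_Suc: "fl (Suc k) u = int (b k) * fl k u + digit k u"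
  by (simp add: fl_eq_div[of k] digit_def)

lemma fl_eq_mono:
  assumes "j \<le> k" "fl k u = fl k v"
  shows "fl j u = fl j v"
  using assms
proof (induction rule: inc_induct)
  case (step n)
  then show ?case
    by (simp add: fl_eq_div[of n])
qed

lemma w_pos: "0 < w k"
  using Q_pos[of "Suc k"] by (simp add: w_def)

lemma term_nonneg: "0 \<le> of_int (digit k u) * w k"
  using w_pos[of k] digit_bounds(1)[of k u] by (intro mult_nonneg_nonneg) auto

lemma S_mono: "n \<le> m \<Longrightarrow> S n u \<le> S m u"
  unfolding S_def by (intro sum_mono2 term_nonneg) auto

text \<open>The last of the \<open>b m\<close> children starts at offset
  \<open>(b m - 1) * w m\<close> and has length \<open>L (Suc m) \<le> w m\<close>, so it ends
  within \<open>b m * w m \<le> L m\<close>. Subtracting \<open>L m\<close> makes the induction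
  telescope.\<close>

lemma S_le: "n \<le> m \<Longrightarrow> S m u \<le> S n u + L n - L m"
proof (induction rule: dec_induct)
  case (step m)
  have "of_int (digit m u) \<le> real (b m) - 1"
    using digit_bounds(2)[of m u] by linarith
  then have "of_int (digit m u) * w m \<le> (real (b m) - 1) * w m"
    using w_pos[of m] by (intro mult_right_mono) auto
  also have "\<dots> \<le> L m - w m"
    using b_less[of m] by (simp add: algebra_simps)
  also have "\<dots> \<le> L m - L (Suc m)"
    using L_le[of "Suc m"] L_pos[of "Suc m"] by (simp add: w_def)
  finally show ?case
    using step.IH by (simp add: S_def)
qed simp

lemma summable_g: "summable (\<lambda>k. of_int (digit k u) * w k)"
proof (rule summableI_nonneg_bounded[OF term_nonneg])
  show "(\<Sum>k<n. of_int (digit k u) * w k) \<le> L 0" for n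
    using S_le[of 0 n u] L_pos[of n] by (simp add: S_def)
qed

lemma g_ge: "S n u \<le> g u"
  unfolding S_def g_def by (intro sum_le_suminf summable_g term_nonneg) auto

lemma g_le: "g u \<le> S n u + L n"
  unfolding g_def
proof (rule suminf_le_const[OF summable_g])
  fix m
  have "S m u \<le> S n u + L n"
  proof (cases "n \<le> m")
    case True
    then show ?thesis
      using S_le[OF True, of u] L_pos[of m] by linarith
  next
    case False
    then show ?thesis
      using S_mono[of m n u] L_pos[of n] by linarith
  qed
  then show "(\<Sum>k<m. of_int (digit k u) * w k) \<le> S n u + L n"
    by (simp add: S_def)
qed

lemma S_cong: "fl k u = fl k v \<Longrightarrow> S k u = S k v"
  unfolding S_def
proof (rule sum.cong[OF refl])
  fix j assume *: "fl k u = fl k v" "j \<in> {..<k}"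
  have "fl (Suc j) u = fl (Suc j) v"
    by (rule fl_eq_mono[OF _ *(1)]) (use *(2) in auto)
  then show "of_int (digit j u) * w j = of_int (digit j v) * w j"
    by (simp add: digit_def)
qed

lemma g_close: "fl k u = fl k v \<Longrightarrow> \<bar>g u - g v\<bar> \<le> L k"
  using S_cong[of k u v] g_ge[of k u] g_le[of u k] g_ge[of k v] g_le[of v k] by linarith

text \<open>With \<open>a = 1 / Q (Suc k) ^ 2\<close>, the left end points differ by
  \<open>2 * a\<close> per unit of digit difference, and the tails change this by at most
  \<open>L (Suc k) \<le> a / 4\<close>. At least half of the difference survives.\<close>

lemma g_apart:
  assumes "fl k u = fl k v" "fl (Suc k) u \<noteq> fl (Suc k) v"
  shows "of_int \<bar>digit k u - digit k v\<bar> / (real (Q (Suc k)))\<^sup>2 \<le> \<bar>g u - g v\<bar>"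
proof -
  define a where "a = 1 / (real (Q (Suc k)))\<^sup>2"
  define D :: real where "D = of_int (digit k u - digit k v)"
  have "a > 0"
    using Q_pos[of "Suc k"] by (simp add: a_def)
  have "digit k u \<noteq> digit k v"
    using assms by (simp add: fl_Suc)
  then have "1 \<le> \<bar>digit k u - digit k v\<bar>"
    by linarith
  then have "1 \<le> \<bar>D\<bar>"
    unfolding D_def by linarith
  then have "1 * a \<le> \<bar>D\<bar> * a"
    using \<open>a > 0\<close> by (intro mult_right_mono) auto
  moreover have "L (Suc k) \<le> a / 4"
    using L_le[of "Suc k"] by (simp add: a_def)
  moreover have "S (Suc k) u - S (Suc k) v = 2 * (D * a)"
    using S_cong[OF assms(1)]
    by (simp add: S_def w_def D_def a_def diff_divide_distrib algebra_simps)
  moreover have "\<bar>D * a\<bar> = \<bar>D\<bar> * a"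
    using \<open>a > 0\<close> by (simp add: abs_mult)
  ultimately have "\<bar>D\<bar> * a \<le> \<bar>g u - g v\<bar>"
    using g_ge[of "Suc k" u] g_le[of u "Suc k"] g_ge[of "Suc k" v] g_le[of v "Suc k"] \<open>a > 0\<close>
    by linarith
  then show ?thesis
    by (simp add: D_def a_def)
qed

lemma ex_first_difference:
  assumes "u \<in> {0..<1}" "v \<in> {0..<1}" "fl n u \<noteq> fl n v"
  obtains k where "k < n" "fl k u = fl k v" "fl (Suc k) u \<noteq> fl (Suc k) v"
proof -
  have "\<exists>k<n. fl k u = fl k v \<and> fl (Suc k) u \<noteq> fl (Suc k) v"
    using assms(3)
  proof (induction n)
    case 0
    then show ?case
      using assms by (simp add: fl_0)
  next
    case (Suc n)
    then show ?case
      by (cases "fl n u = fl n v") (auto intro: less_SucI)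
  qed
  then show thesis
    using that by blast
qed

section \<open>The Hoelder estimate for the inverse of \<open>g\<close>\<close>

lemma fl_separates:
  assumes "u \<noteq> v"
  obtains n where "fl n u \<noteq> fl n v"
proof -
  obtain n where n: "1 / \<bar>u - v\<bar> < 2 ^ n"
    using real_arch_pow[of 2 "1 / \<bar>u - v\<bar>"] by auto
  also have "\<dots> \<le> real (M n)"
    using M_ge[of n] by (metis of_nat_le_iff of_nat_numeral of_nat_power)
  finally have "1 < real (M n) * \<bar>u - v\<bar>"
    using assms by (simp add: field_simps)
  also have "\<dots> = \<bar>real (M n) * u - real (M n) * v\<bar>"
    by (simp add: abs_mult right_diff_distrib[symmetric])
  finally have "fl n u \<noteq> fl n v"
    unfolding fl_def by linarith
  then show thesis
    by (rule that)
qed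

text \<open>
  \<open>M (Suc k)\<close> is at least \<open>Q (Suc k)\<^sup>2 * L k / 4\<close>, and the growth of \<open>Q\<close> makes the factor
  \<open>L k / 4\<close> at least \<open>Q (Suc k) powr - (1 / Suc k)\<close>.
\<close>

lemma M_Suc_ge: "real (Q (Suc k)) powr (2 - 1 / real (Suc k)) \<le> real (M (Suc k))"
proof -
  define R where "R = 4 * (2 * real (Q k)) powr t"
  have "R > 0"
    using Q_pos[of k] by (simp add: R_def)
  have "R = (R ^ Suc k) powr (1 / real (Suc k))"
    using \<open>R > 0\<close> by (simp add: powr_realpow[symmetric] powr_powr del: power_Suc)
  also have "\<dots> \<le> real (Q (Suc k)) powr (1 / real (Suc k))"
    using Q_Suc_ge_power[of k] \<open>R > 0\<close> by (intro powr_mono2) (auto simp: R_def)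
  finally have R_le: "R \<le> real (Q (Suc k)) powr (1 / real (Suc k))" .
  have "real (Q (Suc k)) powr (2 - 1 / real (Suc k)) =
      (real (Q (Suc k)))\<^sup>2 / real (Q (Suc k)) powr (1 / real (Suc k))"
    using Q_pos[of "Suc k"] by (simp add: powr_diff powr_numeral)
  also have "\<dots> \<le> (real (Q (Suc k)))\<^sup>2 / R"
    using R_le \<open>R > 0\<close> Q_pos[of "Suc k"] by (intro divide_left_mono mult_pos_pos) auto
  also have "\<dots> = L k * (real (Q (Suc k)))\<^sup>2 / 4"
    by (simp add: R_def L_def powr_minus field_simps)
  also have "\<dots> \<le> real (b k)"
    by (rule b_ge)
  also have "\<dots> \<le> real (M (Suc k))"
    using mult_le_mono1[of 1 "M k" "b k"] M_pos[of k] by (simp add: M_Suc Suc_le_eq del: of_nat_mult)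
  finally show ?thesis .
qed

text \<open>As \<open>t * s < 2\<close>, the exponent \<open>2 - 1 / Suc k\<close> in the bound for
  \<open>M (Suc k)\<close> exceeds \<open>t * s\<close> for large \<open>k\<close>; the maximum
  \<open>K\<close> absorbs the finitely many other levels.\<close>

lemma powr_Q_le_M:
  assumes "0 < s" "s < 2 / t"
  obtains K where "K > 0" "\<And>k. (2 * real (Q k)) powr (t * s) \<le> K * real (M k)"
proof -
  have "t * s < 2"
    using assms t_gt_2 by (simp add: field_simps)
  define f where "f k = (2 * real (Q k)) powr (t * s) / real (M k)" for k
  obtain N where N: "1 / real (Suc N) < 2 - t * s"
    using reals_Archimedean[of "2 - t * s"] \<open>t * s < 2\<close> by (auto simp: inverse_eq_divide)
  have f_le: "f (Suc k) \<le> 2 powr (t * s)" if "k \<ge> N" for k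
  proof -
    have "1 / real (Suc k) \<le> 1 / real (Suc N)"
      using that by (intro divide_left_mono) auto
    then have "real (Q (Suc k)) powr (t * s) \<le> real (Q (Suc k)) powr (2 - 1 / real (Suc k))"
      using N Q_pos[of "Suc k"] by (intro powr_mono) (auto simp: Suc_le_eq)
    also have "\<dots> \<le> real (M (Suc k))"
      by (rule M_Suc_ge)
    finally have "2 powr (t * s) * real (Q (Suc k)) powr (t * s) \<le> 2 powr (t * s) * real (M (Suc k))"
      by (intro mult_left_mono) auto
    then show ?thesis
      using M_pos[of "Suc k"] by (simp add: f_def powr_mult field_simps)
  qed
  define K where "K = Max (insert (2 powr (t * s)) (f ` {..N}))"
  have "2 powr (t * s) \<le> K"
    unfolding K_def by (intro Max_ge) auto
  show thesis
  proof (rule that)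
    show "K > 0"
      using \<open>2 powr (t * s) \<le> K\<close> by (rule less_le_trans[rotated]) simp
    fix k
    have "f k \<le> K"
    proof (cases "k \<le> N")
      case True
      then show ?thesis
        unfolding K_def by (intro Max_ge) auto
    next
      case False
      then obtain j where "k = Suc j" "j \<ge> N"
        by (cases k) auto
      then show ?thesis
        using f_le[of j] \<open>2 powr (t * s) \<le> K\<close> by simp
    qed
    then show "(2 * real (Q k)) powr (t * s) \<le> K * real (M k)"
      using M_pos[of k] by (simp add: f_def divide_le_eq)
  qed
qed

text \<open>Let \<open>D\<close> be the digit difference at the first level that separates
  \<open>u\<close> and \<open>v\<close>. Then \<open>\<bar>u - v\<bar>\<close> is at most
  \<open>2 * D / (M k * b k)\<close>, and \<open>g u\<close>, \<open>g v\<close> are at least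
  \<open>D / Q (Suc k) ^ 2\<close> apart. The bounds \<open>D \<le> b k\<close> and
  \<open>powr_Q_le_M\<close> turn the first into the \<open>s\<close>-th power of the
  second.\<close>

lemma hoelder_inverse_g:
  assumes s: "0 < s" "s < 2 / t"
  shows "\<exists>C>0. \<forall>u\<in>{0..<1}. \<forall>v\<in>{0..<1}. \<bar>u - v\<bar> \<le> C * dist (g u) (g v) powr s"
proof -
  have "s < 1"
    using s t_gt_2 by (smt (verit) divide_le_eq_1)
  obtain K where K: "K > 0" "\<And>k. (2 * real (Q k)) powr (t * s) \<le> K * real (M k)"
    using powr_Q_le_M[OF s] by blast
  have "\<bar>u - v\<bar> \<le> 8 * K * dist (g u) (g v) powr s"
    if uv: "u \<in> {0..<1}" "v \<in> {0..<1}" "u \<noteq> v" for u v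
  proof -
    obtain n where "fl n u \<noteq> fl n v"
      using fl_separates[OF \<open>u \<noteq> v\<close>] .
    then obtain k where k: "fl k u = fl k v" "fl (Suc k) u \<noteq> fl (Suc k) v"
      using ex_first_difference[OF uv(1,2)] by blast
    define D :: real where "D = of_int \<bar>digit k u - digit k v\<bar>"
    define q where "q = real (Q (Suc k))"
    define m where "m = real (M k)"
    define B where "B = real (b k)"
    have pos: "q > 0" "m > 0" "B > 0"
      using Q_pos M_pos b_ge_2[of k] by (auto simp: q_def m_def B_def)
    have "digit k u \<noteq> digit k v"
      using k by (simp add: fl_Suc)
    then have D1: "1 \<le> D"
      unfolding D_def by linarith
    have DB: "D \<le> B"
      using digit_bounds[of k u] digit_bounds[of k v] unfolding D_def B_def by linarith
    have "of_int \<bar>fl (Suc k) u - fl (Suc k) v\<bar> = D"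
      using k(1) by (simp add: fl_Suc D_def)
    then have "\<bar>real (M (Suc k)) * u - real (M (Suc k)) * v\<bar> \<le> D + 1"
      unfolding fl_def by linarith
    then have "m * B * \<bar>u - v\<bar> \<le> 2 * D"
      using D1 pos by (simp add: M_Suc m_def B_def right_diff_distrib[symmetric] abs_mult)
    then have "\<bar>u - v\<bar> \<le> 2 * D / (m * B)"
      using pos by (simp add: field_simps)
    \<comment> \<open>Only the factor \<open>D powr (1 - s)\<close> is estimated by the branching
      number; the rest is kept for the distance. This needs \<open>s < 1\<close>.\<close>
    also have "D = D powr s * D powr (1 - s)"
      using D1 by (simp add: powr_add[symmetric])
    also have "2 * (D powr s * D powr (1 - s)) / (m * B) \<le> 2 * (D powr s * B powr (1 - s)) / (m * B)"
      using pos D1 DB \<open>s < 1\<close> by (intro divide_right_mono mult_left_mono powr_mono2) auto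
    also have "\<dots> = 2 * D powr s / m * (1 / B powr s)"
      using pos by (simp add: powr_diff)
    also have "\<dots> \<le> 2 * D powr s / m * (4 * (2 * real (Q k)) powr (t * s) / (q\<^sup>2) powr s)"
    proof (intro mult_left_mono)
      have "q\<^sup>2 powr s * L k powr s / 4 powr s = (L k * q\<^sup>2 / 4) powr s"
        using L_pos[of k] by (simp add: powr_mult powr_divide)
      also have "\<dots> \<le> B powr s"
        using b_ge[of k] L_pos[of k] s by (intro powr_mono2) (auto simp: q_def B_def)
      finally have "q\<^sup>2 powr s * L k powr s \<le> 4 powr s * B powr s"
        by (simp add: field_simps)
      also have "\<dots> \<le> 4 powr 1 * B powr s"
        using \<open>s < 1\<close> by (intro mult_right_mono powr_mono) auto
      also have "L k powr s = 1 / (2 * real (Q k)) powr (t * s)"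
        unfolding L_def powr_powr by (simp add: powr_minus_divide)
      finally show "1 / B powr s \<le> 4 * (2 * real (Q k)) powr (t * s) / (q\<^sup>2) powr s"
        using pos Q_pos[of k] by (simp add: field_simps)
    qed (use pos in auto)
    also have "\<dots> \<le> 2 * D powr s / m * (4 * (K * m) / (q\<^sup>2) powr s)"
      using K(2)[of k] pos by (intro mult_left_mono divide_right_mono) (auto simp: m_def)
    also have "\<dots> = 8 * K * (D / q\<^sup>2) powr s"
      using pos D1 by (simp add: powr_divide)
    also have "\<dots> \<le> 8 * K * dist (g u) (g v) powr s"
      using g_apart[OF k] K(1) D1 s
      by (intro mult_left_mono powr_mono2) (auto simp: D_def q_def dist_real_def)
    finally show ?thesis .
  qed
  then have "\<bar>u - v\<bar> \<le> 8 * K * dist (g u) (g v) powr s" if "u \<in> {0..<1}" "v \<in> {0..<1}" for u v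
    using that by (cases "u = v") auto
  then show ?thesis
    using K(1) by (intro exI[of _ "8 * K"]) auto
qed

section \<open>The compact set \<open>F\<close> and its abstract rationals\<close>

lemma F_subset: "F \<subseteq> {0..1}"
proof -
  have "L 0 \<le> 1"
    using L_le[of 0] by simp
  moreover have "0 \<le> g u" "g u \<le> L 0" for u
    using g_ge[of 0 u] g_le[of u 0] by (auto simp: S_def)
  ultimately have "g ` {0..<1} \<subseteq> {0..1}"
    using order_trans by fastforce
  then show ?thesis
    unfolding F_def by (intro closure_minimal) auto
qed

lemma compact_F: "compact F"
proof -
  have "bounded F"
    by (rule bounded_subset[OF bounded_closed_interval F_subset])
  then show ?thesis
    by (simp add: compact_eq_bounded_closed F_def)
qed

lemma g_in_F: "u \<in> {0..<1} \<Longrightarrow> g u \<in> F"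
  unfolding F_def by (rule subsetD[OF closure_subset imageI])

lemma cls_subset: "cls k j \<subseteq> F"
  unfolding cls_def using g_in_F by (intro image_subsetI) simp

text \<open>If two points first differ at the last digit, their digits are congruent modulo
  \<open>Q = Q (Suc k)\<close>, so their distance is at least \<open>Q / Q ^ 2\<close>. If they
  differ earlier, the gap of that level is at least \<open>1 / Q\<close> already.\<close>

lemma separated_cls: "separated_set (1 / real (Q (Suc k))) (cls k j)"
  unfolding separated_set_def
proof (intro ballI impI)
  fix x y assume "x \<in> cls k j" "y \<in> cls k j" "x \<noteq> y"
  then obtain u v where uv: "x = g u" "y = g v" "u \<in> {0..<1}" "v \<in> {0..<1}"
    and ints: "real (M (Suc k)) * u \<in> \<int>" "real (M (Suc k)) * v \<in> \<int>"
    and j: "digit k u mod int (Q (Suc k)) = int j" "digit k v mod int (Q (Suc k)) = int j"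
    unfolding cls_def by blast
  have "real (M (Suc k)) * u \<noteq> real (M (Suc k)) * v"
    using \<open>x \<noteq> y\<close> uv M_pos[of "Suc k"] by auto
  \<comment> \<open>Both products are integers, so taking floors loses nothing.\<close>
  then have "fl (Suc k) u \<noteq> fl (Suc k) v"
    using ints unfolding fl_def by (metis Ints_cases of_int_floor_cancel)
  then obtain i where i: "i < Suc k" "fl i u = fl i v" "fl (Suc i) u \<noteq> fl (Suc i) v"
    using ex_first_difference[OF uv(3,4)] by blast
  define D where "D = \<bar>digit i u - digit i v\<bar>"
  have "digit i u \<noteq> digit i v"
    using i by (simp add: fl_Suc)
  then have D1: "1 \<le> D"
    unfolding D_def by linarith
  have "1 / real (Q (Suc k)) \<le> of_int D / (real (Q (Suc i)))\<^sup>2"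
  proof (cases "i = k")
    case True
    have "int (Q (Suc k)) dvd digit k u - digit k v"
      using j by (simp add: mod_eq_dvd_iff[symmetric])
    then have "int (Q (Suc k)) \<le> D"
      using \<open>digit i u \<noteq> digit i v\<close> True unfolding D_def
      by (intro zdvd_imp_le) auto
    then have "real (Q (Suc k)) \<le> of_int D"
      by linarith
    then have "real (Q (Suc k)) / (real (Q (Suc k)))\<^sup>2 \<le> of_int D / (real (Q (Suc k)))\<^sup>2"
      by (intro divide_right_mono) auto
    then show ?thesis
      using True Q_pos[of "Suc k"] by (simp add: power2_eq_square)
  next
    case False
    then have "(Q (Suc i))\<^sup>2 \<le> Q (Suc k)"
      using i(1) Q_Suc_ge_square[of "Suc i"] Q_mono[of "Suc (Suc i)" "Suc k"] by linarith
    then have "(real (Q (Suc i)))\<^sup>2 \<le> real (Q (Suc k))"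
      by (metis of_nat_le_iff of_nat_power)
    then have "1 / real (Q (Suc k)) \<le> 1 / (real (Q (Suc i)))\<^sup>2"
      using Q_pos[of "Suc i"] Q_pos[of "Suc k"] by (intro divide_left_mono) auto
    also have "\<dots> \<le> of_int D / (real (Q (Suc i)))\<^sup>2"
      using D1 by (intro divide_right_mono) auto
    finally show ?thesis .
  qed
  also have "\<dots> \<le> dist x y"
    using g_apart[OF i(2,3)] by (simp add: D_def uv dist_real_def)
  finally show "1 / real (Q (Suc k)) \<le> dist x y" .
qed

text \<open>Every \<open>g v\<close> is within \<open>L (Suc k)\<close> of the left end point of its
  interval. There are finitely many such end points, so the union of the balls is closed and also
  covers the closure \<open>F\<close>.\<close>

lemma F_covered:
  assumes "x \<in> F"
  obtains j a where "j < Q (Suc k)" "a \<in> cls k j" "dist a x \<le> L (Suc k)"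
proof -
  let ?M = "real (M (Suc k))"
  define G where "G = {u \<in> {0..<1}. ?M * u \<in> \<int>}"
  have M: "?M > 0"
    using M_pos[of "Suc k"] by simp
  have "G \<subseteq> (\<lambda>n. of_int n / ?M) ` {0..int (M (Suc k))}"
  proof
    fix u assume u: "u \<in> G"
    then obtain n where n: "?M * u = of_int n"
      by (auto simp: G_def Ints_def)
    have "0 \<le> ?M * u" "?M * u \<le> ?M * 1"
      using u M by (auto simp: G_def intro!: mult_left_mono)
    then have "n \<in> {0..int (M (Suc k))}"
      unfolding n by simp
    moreover have "u = of_int n / ?M"
      using n M by (simp add: field_simps)
    ultimately show "u \<in> (\<lambda>n. of_int n / ?M) ` {0..int (M (Suc k))}"
      by blast
  qed
  then have "finite G"
    by (rule finite_subset) simp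
  then have "closed (\<Union>u\<in>G. cball (g u) (L (Suc k)))"
    by (intro closed_UN) auto
  moreover have "g ` {0..<1} \<subseteq> (\<Union>u\<in>G. cball (g u) (L (Suc k)))"
  proof clarify
    fix v :: real assume v: "v \<in> {0..<1}"
    define u where "u = of_int (fl (Suc k) v) / ?M"
    have Mu: "?M * u = of_int (fl (Suc k) v)"
      using M by (simp add: u_def)
    have "0 \<le> fl (Suc k) v" "of_int (fl (Suc k) v) \<le> ?M * v"
      using v by (simp_all add: fl_def)
    then have "0 \<le> u" "u \<le> v"
      using M by (simp_all add: u_def field_simps)
    then have "u \<in> G"
      using v Mu by (simp add: G_def)
    moreover have "fl (Suc k) u = fl (Suc k) v"
      unfolding fl_def[of _ u] Mu by simp
    then have "dist (g u) (g v) \<le> L (Suc k)"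
      unfolding dist_real_def by (rule g_close)
    ultimately show "g v \<in> (\<Union>u\<in>G. cball (g u) (L (Suc k)))"
      by auto
  qed
  ultimately have "F \<subseteq> (\<Union>u\<in>G. cball (g u) (L (Suc k)))"
    unfolding F_def by (intro closure_minimal)
  then obtain u where u: "u \<in> G" "dist (g u) x \<le> L (Suc k)"
    using assms by auto
  define j where "j = nat (digit k u mod int (Q (Suc k)))"
  have "0 \<le> digit k u mod int (Q (Suc k))" "digit k u mod int (Q (Suc k)) < int (Q (Suc k))"
    using Q_pos[of "Suc k"] by auto
  then have "j < Q (Suc k)" "digit k u mod int (Q (Suc k)) = int j"
    unfolding j_def by auto
  moreover from this u have "g u \<in> cls k j"
    by (auto simp: cls_def G_def)
  ultimately show thesis
    using u that by blast
qed

text \<open>Each denominator has at most one form \<open>Q (Suc k) + j\<close> with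
  \<open>j < Q (Suc k)\<close>; \<open>P\<close> extends \<open>cls k j\<close> there and is an
  arbitrary maximal set elsewhere. Each level then supplies every point of \<open>F\<close> with one
  good approximation.\<close>

lemma ex_abstract_rationals:
  obtains P where "abstract_rationals F P" "well_approx F P t = F"
proof -
  have "\<exists>A. maximal_separated (1 / real q) F A \<and>
      (\<forall>k j. j < Q (Suc k) \<longrightarrow> q = Q (Suc k) + j \<longrightarrow> cls k j \<subseteq> A)" for q
  proof (cases "\<exists>k j. j < Q (Suc k) \<and> q = Q (Suc k) + j")
    case True
    then obtain k j where kj: "j < Q (Suc k)" "q = Q (Suc k) + j"
      by blast
    have "separated_set (1 / real q) (cls k j)"
      using separated_cls by (rule separated_set_mono) (use Q_pos[of "Suc k"] kj in \<open>auto simp: field_simps\<close>)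
    then obtain A where A: "maximal_separated (1 / real q) F A" "cls k j \<subseteq> A"
      using ex_maximal_separated_superset[OF cls_subset] by blast
    \<comment> \<open>The level is determined because the blocks of denominators are disjoint;
      \<open>j\<close> then follows by subtraction.\<close>
    have unique: "k' = k" if "j' < Q (Suc k')" "q = Q (Suc k') + j'" for k' j'
    proof (rule linorder_cases[of k k'])
      assume "k < k'"
      then show ?thesis
        using kj that Q_Suc_ge_double[of "Suc k"] Q_mono[of "Suc (Suc k)" "Suc k'"] by linarith
    next
      assume "k' < k"
      then show ?thesis
        using kj that Q_Suc_ge_double[of "Suc k'"] Q_mono[of "Suc (Suc k')" "Suc k"] by linarith
    qed simp
    have "cls k' j' \<subseteq> A" if "j' < Q (Suc k')" "q = Q (Suc k') + j'" for k' j'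
      using unique[OF that] that kj A(2) by auto
    then show ?thesis
      using A(1) by blast
  next
    case False
    have "\<exists>A. maximal_separated (1 / real q) F A"
      by (rule ex_maximal_separated_superset[of "{}" F "1 / real q"]) (auto simp: separated_set_def)
    with False show ?thesis
      by blast
  qed
  then obtain P where P: "\<And>q. maximal_separated (1 / real q) F (P q)"
    "\<And>k j. j < Q (Suc k) \<Longrightarrow> cls k j \<subseteq> P (Q (Suc k) + j)"
    by metis
  have "\<exists>q>N. \<exists>p\<in>P q. dist p x \<le> 1 / real q powr t" if "x \<in> F" for x N
  proof -
    obtain j a where j: "j < Q (Suc N)" "a \<in> cls N j" "dist a x \<le> L (Suc N)"
      using F_covered[OF \<open>x \<in> F\<close>, of N] .
    define q where "q = Q (Suc N) + j"
    have "N < q"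
      using less_Q[of "Suc N"] by (simp add: q_def)
    have "dist a x \<le> (2 * real (Q (Suc N))) powr - t"
      using j(3) by (simp add: L_def)
    also have "\<dots> \<le> real q powr - t"
      using j(1) t_gt_2 \<open>N < q\<close> by (intro powr_mono2') (auto simp: q_def)
    also have "\<dots> = 1 / real q powr t"
      by (simp add: powr_minus divide_inverse)
    finally show ?thesis
      using P(2)[OF j(1)] j(2) \<open>N < q\<close> unfolding q_def by blast
  qed
  then have "well_approx F P t = F"
    unfolding well_approx_def by fastforce
  moreover have "abstract_rationals F P"
    unfolding abstract_rationals_def using P(1) by blast
  ultimately show thesis
    using that by blast
qed

lemma hausdorff_dim_F_ge: "ereal (2 / t) \<le> hausdorff_dim F"
proof (rule hausdorff_dim_ge[OF _ _ hoelder_inverse_g])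
  show "g ` {0..<1} \<subseteq> F"
    using g_in_F by blast
  show "0 < 2 / t"
    using t_gt_2 by simp
qed

end

section \<open>Sharpness of the upper bound\<close>

lemma ex_sharp_example:
  fixes t :: real
  assumes "t > 2"
  shows "\<exists>(F :: real set) P.
    compact F \<and> F \<subseteq> {0..1} \<and> F \<noteq> {} \<and> abstract_rationals F P \<and>
    packing_dim F = 1 \<and> well_approx F P t = F \<and> hausdorff_dim F = ereal (2 / t)"
proof -
  interpret jarnik_cantor t
    by unfold_locales fact
  obtain P where P: "abstract_rationals F P" "well_approx F P t = F"
    by (rule ex_abstract_rationals)
  have packing_le: "packing_dim F \<le> 1"
    using packing_dim_le_upper_box_dim upper_box_dim_unit_interval_le[OF F_subset]
    by (rule order_trans)
  have upper: "hausdorff_dim F \<le> (packing_dim F + 1) / ereal t"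
    using hausdorff_dim_well_approx_le[OF P(1), of t] P(2) \<open>t > 2\<close> by simp
  have two: "ereal (2 / t) = (1 + 1) / ereal t"
    using \<open>t > 2\<close> by (simp add: one_ereal_def)
  have "ereal (2 / t) \<le> (packing_dim F + 1) / ereal t"
    using hausdorff_dim_F_ge upper by (rule order_trans)
  \<comment> \<open>Clearing the denominator \<open>t\<close> leaves
    \<open>2 \<le> packing_dim F + 1\<close>.\<close>
  then have "1 \<le> packing_dim F"
    using \<open>t > 2\<close> by (cases "packing_dim F") (simp_all add: one_ereal_def divide_le_cancel)
  with packing_le have packing: "packing_dim F = 1"
    by (rule order_antisym)
  have "hausdorff_dim F \<le> ereal (2 / t)"
    using upper unfolding packing two .
  then have "hausdorff_dim F = ereal (2 / t)"
    using hausdorff_dim_F_ge by (rule order_antisym)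
  moreover have "F \<noteq> {}"
    using g_in_F[of 0] by auto
  ultimately show ?thesis
    using compact_F F_subset P packing by blast
qed

theorem proposition2p2:
  shows "(\<forall>t::real. t > 2 \<longrightarrow>
           (\<exists>(F :: real set) P.
              compact F \<and> F \<subseteq> {0..1} \<and> F \<noteq> {} \<and> abstract_rationals F P \<and>
              packing_dim F = 1 \<and>
              hausdorff_dim (well_approx F P t) = hausdorff_dim F \<and>
              hausdorff_dim F = ereal (2 / t) \<and>
              ereal (2 / t) = (packing_dim F + 1) / ereal t \<and>
              \<not> hausdorff_dim (well_approx F P t) \<le> (hausdorff_dim F + 1) / ereal t)) \<and>
         (\<forall>t::real. t \<ge> 1 \<longrightarrow>
           (\<forall>(F :: 'a::metric_space set) P.
              F \<noteq> {} \<longrightarrow> totally_bounded F \<longrightarrow> abstract_rationals F P \<longrightarrow>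
              hausdorff_dim (well_approx F P t) \<le> (packing_dim F + 1) / ereal t))"
proof (intro conjI allI impI)
  fix t :: real assume "t > 2"
  then obtain F :: "real set" and P where F: "compact F" "F \<subseteq> {0..1}" "F \<noteq> {}"
    "abstract_rationals F P" "packing_dim F = 1" "well_approx F P t = F"
    "hausdorff_dim F = ereal (2 / t)"
    using ex_sharp_example by metis
  \<comment> \<open>Equivalent to \<open>2 / t < 1\<close>, that is, to
    \<open>t > 2\<close>.\<close>
  have "(2 / t + 1) / t < 2 / t"
    using \<open>t > 2\<close> by (simp add: field_simps)
  then have "\<not> hausdorff_dim F \<le> (hausdorff_dim F + 1) / ereal t"
    using \<open>t > 2\<close> by (simp add: F(7) one_ereal_def)
  moreover have "ereal (2 / t) = (packing_dim F + 1) / ereal t"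
    using \<open>t > 2\<close> by (simp add: F(5) one_ereal_def)
  ultimately show "\<exists>(F :: real set) P.
      compact F \<and> F \<subseteq> {0..1} \<and> F \<noteq> {} \<and> abstract_rationals F P \<and> packing_dim F = 1 \<and>
      hausdorff_dim (well_approx F P t) = hausdorff_dim F \<and> hausdorff_dim F = ereal (2 / t) \<and>
      ereal (2 / t) = (packing_dim F + 1) / ereal t \<and>
      \<not> hausdorff_dim (well_approx F P t) \<le> (hausdorff_dim F + 1) / ereal t"
    using F by (intro exI[of _ F] exI[of _ P]) simp
next
  fix t :: real and F :: "'a set" and P assume "1 \<le> t" "abstract_rationals F P"
  then show "hausdorff_dim (well_approx F P t) \<le> (packing_dim F + 1) / ereal t"
    by (intro hausdorff_dim_well_approx_le)
qed

end
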